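(* The diagram formed by $\xi:M\to\mathrm{GL}_1\times\mathrm{GL}_6$, the generalized determinant $\nu:\mathrm{GL}_1\times\mathrm{GL}_6\to\mathbb G_m$, $\nu(a,g)=a$, and the character $\gamma_0:M\to\mathbb G_m$ commutes, i.e. $\nu\circ\xi=\gamma_0$.
   Context: $G$ is the split simply connected group of type $E_6$ over a $p$-adic field $F$, with simple roots $\alpha_1,\dots,\alpha_6$ in Bourbaki's labelling (chain $\alpha_1,\alpha_3,\alpha_4,\alpha_5,\alpha_6$, with $\alpha_2$ attached to $\alpha_4$). $P=MN$ is the standard maximal parabolic subgroup obtained by deleting $\alpha_2$, and $M_D\simeq\mathrm{SL}_6$ is the derived group of $M$, with $\alpha_1^\vee,\alpha_3^\vee,\alpha_4^\vee,\alpha_5^\vee,\alpha_6^\vee$ identified in this order with the standard simple coroots of $\mathrm{SL}_6$ ($\alpha_1^\vee(t)\mapsto\mathrm{diag}(t,t^{-1},1,1,1,1)$, etc.). The highest root is $\gamma_0=\alpha_1+2\alpha_2+2\alpha_3+3\alpha_4+2\alpha_5+\alpha_6$; being orthogonal to the roots of $M$, it extends to a character of $M$. $A_M=\{\gamma_0^\vee(t)\}$, with $\gamma_0^\vee(t)=\alpha_1^\vee(t)\alpha_2^\vee(t^2)\alpha_3^\vee(t^2)\alpha_4^\vee(t^3)\alpha_5^\vee(t^2)\alpha_6^\vee(t)$. One has $M\simeq(\mathrm{GL}_1\times\mathrm{SL}_6)/\{(t,tI_6):t^2=1\}$ with $\mathrm{GL}_1\simeq A_M$ via $\gamma_0^\vee$,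 and $\xi:M\to\mathrm{GL}_1\times\mathrm{GL}_6$ is the map induced by $A_M\times M_D\to\mathrm{GL}_1\times\mathrm{GL}_6$, $(\gamma_0^\vee(t),x)\mapsto(t^2,tx)$. (The image of $\xi$ lies in the $L$-monoid $\{(a,g)\in\mathbb A^1\times\mathrm{Mat}_{6\times6}:a^3=\det g\}$ of the exterior cube representation, whose generalized determinant is $\nu$.) *)

theory Defs
  imports
    "HOL-Algebra.Algebraic_Closure_Type"
    "HOL-Algebra.Solvable_Groups"
    "Jordan_Normal_Form.Determinant"
begin

text \<open>
  Algebraic groups over a \<open>p\<close>-adic field \<open>F\<close> are rendered by their groups of points over the
  algebraic closure \<open>F alg_closure\<close>; morphisms over \<open>F\<close> are maps on these points whose matrix
  entries are polynomials with coefficients in \<open>F\<close>.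
\<close>

text \<open>
  \<open>v\<close> is an absolute value making \<open>'f\<close> a \<open>p\<close>-adic field: characteristic 0 (from the type class),
  non-archimedean, non-trivial and discrete, complete, with finite residue field.
\<close>

definition padic_field :: "('f::field_char_0 \<Rightarrow> real) \<Rightarrow> bool" where
  "padic_field v \<longleftrightarrow>
     (\<forall>x. v x \<ge> 0) \<and> (\<forall>x. v x = 0 \<longleftrightarrow> x = 0) \<and>
     (\<forall>x y. v (x * y) = v x * v y) \<and>
     (\<forall>x y. v (x + y) \<le> max (v x) (v y)) \<and>
     (\<exists>\<pi>. 0 < v \<pi> \<and> v \<pi> < 1 \<and> (\<forall>x. v x < 1 \<longrightarrow> v x \<le> v \<pi>)) \<and>
     (\<forall>s::nat \<Rightarrow> 'f.
        (\<forall>e>0. \<exists>N. \<forall>m\<ge>N. \<forall>n\<ge>N. v (s m - s n) < e) \<longrightarrow>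
        (\<exists>l. \<forall>e>0. \<exists>N. \<forall>n\<ge>N. v (s n - l) < e)) \<and>
     (\<exists>R. finite R \<and> (\<forall>x. v x \<le> 1 \<longrightarrow> (\<exists>r\<in>R. v (x - r) < 1)))"

subsection \<open>Linear groups and morphisms\<close>

definition Gm :: "'k::field monoid" where
  "Gm = \<lparr>carrier = UNIV - {0}, monoid.mult = (*), one = 1\<rparr>"

definition GL :: "nat \<Rightarrow> 'k::field mat monoid" where
  "GL n = units_of (ring_mat TYPE('k) n ())"

definition SL :: "nat \<Rightarrow> 'k::field mat monoid" where
  "SL n = (GL n)\<lparr>carrier := {A \<in> carrier (GL n). det A = 1}\<rparr>"

inductive_set poly_funs :: "'k::field set \<Rightarrow> nat \<Rightarrow> ('k mat \<Rightarrow> 'k) set"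
  for C :: "'k set" and n :: nat where
  const: "c \<in> C \<Longrightarrow> (\<lambda>A. c) \<in> poly_funs C n"
| entry: "i < n \<Longrightarrow> j < n \<Longrightarrow> (\<lambda>A. A $$ (i, j)) \<in> poly_funs C n"
| add: "p \<in> poly_funs C n \<Longrightarrow> q \<in> poly_funs C n \<Longrightarrow> (\<lambda>A. p A + q A) \<in> poly_funs C n"
| mult: "p \<in> poly_funs C n \<Longrightarrow> q \<in> poly_funs C n \<Longrightarrow> (\<lambda>A. p A * q A) \<in> poly_funs C n"

text \<open>
  All matrix groups below are closed subgroups of \<open>SL n\<close>, so that no inverse of the
  determinant is needed among the regular functions.
\<close>

definition regular_fun :: "'k::field set \<Rightarrow> nat \<Rightarrow> 'k mat set \<Rightarrow> ('k mat \<Rightarrow> 'k) \<Rightarrow> bool" where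
  "regular_fun C n S f \<longleftrightarrow> (\<exists>p\<in>poly_funs C n. \<forall>A\<in>S. f A = p A)"

definition regular_map ::
  "'k::field set \<Rightarrow> nat \<Rightarrow> nat \<Rightarrow> 'k mat set \<Rightarrow> ('k mat \<Rightarrow> 'k mat) \<Rightarrow> bool" where
  "regular_map C n m S f \<longleftrightarrow> (\<forall>i<m. \<forall>j<m. regular_fun C n S (\<lambda>A. f A $$ (i, j)))"

subsection \<open>The group of type \<open>E\<^sub>6\<close>\<close>

definition cartan :: "nat \<Rightarrow> nat \<Rightarrow> int" where
  "cartan i j = (if i = j then 2
     else if (i, j) \<in> {(1,3),(3,1),(3,4),(4,3),(4,5),(5,4),(5,6),(6,5),(2,4),(4,2)} then -1
     else 0)"

text \<open>
  The weights of the 27-dimensional minuscule representation of highest weight \<open>\<omega>\<^sub>1\<close>; the weight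
  \<open>\<mu>\<close> is listed as \<open>[\<langle>\<mu>,\<alpha>\<^sub>1\<^sup>\<vee>\<rangle>, \<dots>, \<langle>\<mu>,\<alpha>\<^sub>6\<^sup>\<vee>\<rangle>]\<close>.
\<close>

definition weights27 :: "int list list" where
  "weights27 =
    [[ 1, 0, 0, 0, 0, 0], [-1, 0, 1, 0, 0, 0], [ 0, 0,-1, 1, 0, 0],
     [ 0, 1, 0,-1, 1, 0], [ 0,-1, 0, 0, 1, 0], [ 0, 1, 0, 0,-1, 1],
     [ 0,-1, 0, 1,-1, 1], [ 0, 1, 0, 0, 0,-1], [ 0, 0, 1,-1, 0, 1],
     [ 0,-1, 0, 1, 0,-1], [ 1, 0,-1, 0, 0, 1], [ 0, 0, 1,-1, 1,-1],
     [-1, 0, 0, 0, 0, 1], [ 1, 0,-1, 0, 1,-1], [ 0, 0, 1, 0,-1, 0],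
     [-1, 0, 0, 0, 1,-1], [ 1, 0,-1, 1,-1, 0], [-1, 0, 0, 1,-1, 0],
     [ 1, 1, 0,-1, 0, 0], [-1, 1, 1,-1, 0, 0], [ 1,-1, 0, 0, 0, 0],
     [-1,-1, 1, 0, 0, 0], [ 0, 1,-1, 0, 0, 0], [ 0,-1,-1, 1, 0, 0],
     [ 0, 0, 0,-1, 1, 0], [ 0, 0, 0, 0,-1, 1], [ 0, 0, 0, 0, 0,-1]]"

definition wt :: "nat \<Rightarrow> nat \<Rightarrow> int" where
  "wt k i = weights27 ! k ! (i - 1)"

text \<open>Sanity check: the list is without repetitions and stable under the simple reflections.\<close>

lemma weights27_reflection_closed:
  "distinct weights27 \<and> length weights27 = 27 \<and>
   (\<forall>\<mu>\<in>set weights27. \<forall>i\<in>set [1..<7].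
      map (\<lambda>j. \<mu> ! (j - 1) - \<mu> ! (i - 1) * cartan i j) [1..<7] \<in> set weights27)"
  by code_simp

definition wt_plus_root :: "nat \<Rightarrow> nat \<Rightarrow> nat \<Rightarrow> bool" where
  "wt_plus_root i k j \<longleftrightarrow> (\<forall>l\<in>set [1..<7]. wt j l = wt k l + cartan i l)"

text \<open>
  In a minuscule representation the simple root vectors \<open>e\<^sub>i\<close>, \<open>f\<^sub>i\<close> may be taken to send each weight
  vector \<open>v\<^sub>\<mu>\<close> to \<open>v\<^bsub>\<mu>+\<alpha>\<^sub>i\<^esub>\<close>, \<open>v\<^bsub>\<mu>-\<alpha>\<^sub>i\<^esub>\<close>, or to 0 if that is not a weight. Their squares vanish, so
  \<open>x\<^bsub>\<alpha>\<^sub>i\<^esub>(t) = exp (t e\<^sub>i) = 1 + t e\<^sub>i\<close>, and likewise for \<open>-\<alpha>\<^sub>i\<close>.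
\<close>

definition root_vec :: "nat \<Rightarrow> 'k::field mat" where
  "root_vec i = mat 27 27 (\<lambda>(j, k). if wt_plus_root i k j then 1 else 0)"

definition x_pos :: "nat \<Rightarrow> 'k::field \<Rightarrow> 'k mat" where
  "x_pos i t = 1\<^sub>m 27 + t \<cdot>\<^sub>m root_vec i"

definition x_neg :: "nat \<Rightarrow> 'k::field \<Rightarrow> 'k mat" where
  "x_neg i t = 1\<^sub>m 27 + t \<cdot>\<^sub>m transpose_mat (root_vec i)"

text \<open>
  Chevalley's construction: the weights above generate the full weight lattice of \<open>E\<^sub>6\<close>, so the
  group generated by the root elements is the simply connected one.
\<close>

definition E6 :: "'k::field mat monoid" where
  "E6 = (GL 27)\<lparr>carrier := generate (GL 27)
     (\<Union>i\<in>{1..6}. range (x_pos i) \<union> range (x_neg i))\<rparr>"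

definition coroot :: "nat \<Rightarrow> 'k::field \<Rightarrow> 'k mat" where
  "coroot i t = mat 27 27 (\<lambda>(j, k). if j = k then t powi wt j i else 0)"

definition torus_elt :: "(nat \<Rightarrow> 'k::field) \<Rightarrow> 'k mat" where
  "torus_elt t = coroot 1 (t 1) * coroot 2 (t 2) * coroot 3 (t 3) *
                 coroot 4 (t 4) * coroot 5 (t 5) * coroot 6 (t 6)"

definition torus :: "'k::field mat set" where
  "torus = {torus_elt t | t. \<forall>i\<in>{1..6}. t i \<noteq> 0}"

text \<open>
  The Levi subgroup \<open>M \<supseteq> T\<close> of the standard maximal parabolic subgroup obtained by deleting
  \<open>\<alpha>\<^sub>2\<close> is generated by \<open>T\<close> and the root subgroups of \<open>\<plusminus>\<alpha>\<^sub>i\<close>, \<open>i \<noteq> 2\<close>.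
\<close>

definition levi :: "'k::field mat monoid" where
  "levi = E6\<lparr>carrier := generate E6
     (torus \<union> (\<Union>i\<in>{1,3,4,5,6}. range (x_pos i) \<union> range (x_neg i)))\<rparr>"

definition levi_der :: "'k::field mat monoid" where
  "levi_der = levi\<lparr>carrier := derived levi (carrier levi)\<rparr>"

subsection \<open>The maps of the diagram\<close>

text \<open>Coefficients of the highest root \<open>\<gamma>\<^sub>0\<close> in the simple roots, and of \<open>\<gamma>\<^sub>0\<^sup>\<vee>\<close> in the simple coroots.\<close>

definition gamma0_coeff :: "nat \<Rightarrow> int" where
  "gamma0_coeff i = [1, 2, 2, 3, 2, 1] ! (i - 1)"

definition gamma0_pairing :: "nat \<Rightarrow> int" where
  "gamma0_pairing j = (\<Sum>i\<in>{1..6}. gamma0_coeff i * cartan i j)"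

definition gamma0_coroot :: "'k::field \<Rightarrow> 'k mat" where
  "gamma0_coroot t = torus_elt (\<lambda>i. t powi gamma0_coeff i)"

text \<open>
  \<open>\<chi>\<close> is a character of \<open>M\<close> over \<open>F\<close> whose restriction to the maximal torus is the root \<open>\<gamma>\<^sub>0\<close>.
\<close>

definition gamma0_character :: "('f::field alg_closure mat \<Rightarrow> 'f alg_closure) \<Rightarrow> bool" where
  "gamma0_character \<chi> \<longleftrightarrow>
     \<chi> \<in> hom levi Gm \<and> regular_fun (range to_ac) 27 (carrier levi) \<chi> \<and>
     (\<forall>t. (\<forall>i\<in>{1..6}. t i \<noteq> 0) \<longrightarrow>
        \<chi> (torus_elt t) = (\<Prod>i\<in>{1..6}. t i powi gamma0_pairing i))"

definition std_coroot :: "nat \<Rightarrow> 'k::field \<Rightarrow> 'k mat" where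
  "std_coroot k t = mat 6 6 (\<lambda>(i, j). if i \<noteq> j then 0
     else if i = k then t else if i = Suc k then inverse t else 1)"

definition SL6_identification ::
  "('f::field alg_closure mat \<Rightarrow> 'f alg_closure mat) \<Rightarrow> bool" where
  "SL6_identification \<phi> \<longleftrightarrow>
     \<phi> \<in> iso (SL 6) levi_der \<and>
     regular_map (range to_ac) 6 27 (carrier (SL 6)) \<phi> \<and>
     regular_map (range to_ac) 27 6 (carrier levi_der) (inv_into (carrier (SL 6)) \<phi>) \<and>
     (\<forall>k<5. \<forall>t. t \<noteq> 0 \<longrightarrow> \<phi> (std_coroot k t) = coroot ([1, 3, 4, 5, 6] ! k) t)"

text \<open>
  The map on \<open>M\<close> induced by \<open>A\<^sub>M \<times> M\<^sub>D \<rightarrow> GL\<^sub>1 \<times> GL\<^sub>6\<close>, \<open>(\<gamma>\<^sub>0\<^sup>\<vee>(t), x) \<mapsto> (t\<^sup>2, t x)\<close>, where \<open>M\<^sub>D\<close> is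
  identified with \<open>SL\<^sub>6\<close> by \<open>\<phi>\<close>.
\<close>

definition xi :: "('k::field mat \<Rightarrow> 'k mat) \<Rightarrow> 'k mat \<Rightarrow> 'k \<times> 'k mat" where
  "xi \<phi> m = (THE p. \<exists>t x. t \<noteq> 0 \<and> x \<in> carrier (SL 6) \<and>
     m = gamma0_coroot t * \<phi> x \<and> p = (t ^ 2, t \<cdot>\<^sub>m x))"

definition nu :: "'k::field \<times> 'k mat \<Rightarrow> 'k" where
  "nu = (\<lambda>(a, g). a)"

subsection \<open>The coroots take values in the group\<close>

text \<open>
  All matrices involved combine the diagonal with the permutation of the weights induced by one
  simple reflection; this reduces the usual formula
  \<open>\<alpha>\<^sup>\<vee>(t) = w\<^bsub>\<alpha>\<^esub>(t) w\<^bsub>\<alpha>\<^esub>(-1)\<close>, \<open>w\<^bsub>\<alpha>\<^esub>(t) = x\<^bsub>\<alpha>\<^esub>(t) x\<^bsub>-\<alpha>\<^esub>(-t\<^sup>-\<^sup>1) x\<^bsub>\<alpha>\<^esub>(t)\<close>, to a computation with indices.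
\<close>

definition refl_index :: "nat \<Rightarrow> nat \<Rightarrow> nat" where
  "refl_index i j = (THE k. k < 27 \<and> (\<forall>l\<in>{1..6}. wt k l = wt j l - wt j i * cartan i l))"

lemma weights27_coords: "\<forall>\<mu>\<in>set weights27. length \<mu> = 6 \<and> set \<mu> \<subseteq> set [-1, 0, 1]"
  by code_simp

lemma wt_eqI:
  assumes "j < 27" "k < 27" "\<And>l. l \<in> {1..6} \<Longrightarrow> wt j l = wt k l"
  shows "j = k"
proof -
  have len: "length weights27 = 27" and d: "distinct weights27"
    using weights27_reflection_closed by blast+
  have l6: "length (weights27 ! j) = 6" "length (weights27 ! k) = 6"
    using weights27_coords assms(1,2) len nth_mem by metis+
  have "weights27 ! j = weights27 ! k"
  proof (rule nth_equalityI)
    fix n assume "n < length (weights27 ! j)"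
    then show "weights27 ! j ! n = weights27 ! k ! n"
      using assms(3)[of "Suc n"] l6 by (simp add: wt_def)
  qed (use l6 in simp)
  then show ?thesis using d assms(1,2) len by (simp add: nth_eq_iff_index_eq)
qed

lemma refl_index:
  assumes "i \<in> {1..6}" "j < 27"
  shows "refl_index i j < 27"
    and "\<And>l. l \<in> {1..6} \<Longrightarrow> wt (refl_index i j) l = wt j l - wt j i * cartan i l"
proof -
  have len: "length weights27 = 27" using weights27_reflection_closed by blast
  have mem: "weights27 ! j \<in> set weights27" using assms(2) len by simp
  have i: "i \<in> set [1..<7]" using assms(1) by auto
  let ?r = "map (\<lambda>l. weights27 ! j ! (l - 1) - weights27 ! j ! (i - 1) * cartan i l) [1..<7]"
  have "?r \<in> set weights27" using weights27_reflection_closed mem i by blast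
  then obtain k where k: "k < 27" "weights27 ! k = ?r" using len by (auto simp: in_set_conv_nth)
  have wk: "wt k l = wt j l - wt j i * cartan i l" if "l \<in> {1..6}" for l
  proof -
    have "l - 1 < length [1..<7]" "[1..<7] ! (l - 1) = l" using that by (auto simp: nth_upt)
    then show ?thesis unfolding wt_def k(2) by (subst nth_map) auto
  qed
  have "\<exists>!k. k < 27 \<and> (\<forall>l\<in>{1..6}. wt k l = wt j l - wt j i * cartan i l)"
  proof (rule ex1I[of _ k])
    fix k' assume "k' < 27 \<and> (\<forall>l\<in>{1..6}. wt k' l = wt j l - wt j i * cartan i l)"
    then show "k' = k" using k(1) wk by (intro wt_eqI) auto
  qed (use k wk in auto)
  from theI'[OF this] show "refl_index i j < 27"
    "\<And>l. l \<in> {1..6} \<Longrightarrow> wt (refl_index i j) l = wt j l - wt j i * cartan i l"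
    unfolding refl_index_def by auto
qed

lemma refl_index_facts:
  "\<forall>i\<in>set [1..<7]. \<forall>j\<in>set [0..<27].
    refl_index i j < 27 \<and> wt (refl_index i j) i = - wt j i \<and>
    refl_index i (refl_index i j) = j \<and> wt j i \<in> {-1,0,1} \<and>
    (\<forall>k\<in>set [0..<27]. wt_plus_root i k j \<longleftrightarrow> wt j i = 1 \<and> k = refl_index i j)"
proof (intro ballI)
  fix i j assume "i \<in> set [1..<(7::nat)]" "j \<in> set [0..<(27::nat)]"
  then have i: "i \<in> {1..6}" and j: "j < 27" by auto
  note r = refl_index[OF i j]
  have len: "length weights27 = 27" using weights27_reflection_closed by blast
  have vals: "wt k i \<in> {-1,0,1}" if "k < 27" for k
  proof -
    have "weights27 ! k \<in> set weights27" using that len by simp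
    then have "length (weights27 ! k) = 6" "set (weights27 ! k) \<subseteq> set [-1, 0, 1]"
      using weights27_coords by blast+
    moreover from this have "weights27 ! k ! (i - 1) \<in> set (weights27 ! k)"
      using i by (intro nth_mem) auto
    ultimately show ?thesis unfolding wt_def by auto
  qed
  have ii: "cartan i i = 2" by (simp add: cartan_def)
  have neg: "wt (refl_index i j) i = - wt j i" using r(2)[OF i] ii by simp
  have inv: "refl_index i (refl_index i j) = j"
    using refl_index[OF i r(1)] r j neg by (intro wt_eqI) auto
  have root: "wt_plus_root i k j \<longleftrightarrow> wt j i = 1 \<and> k = refl_index i j" if k: "k < 27" for k
  proof
    assume w: "wt_plus_root i k j"
    then have e: "wt j l = wt k l + cartan i l" if "l \<in> {1..6}" for l
      using that by (auto simp: wt_plus_root_def)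
    have "wt j i = wt k i + 2" using e[OF i] ii by simp
    then have one: "wt j i = 1" using vals[OF k] vals[OF j] by auto
    moreover have "k = refl_index i j"
      using k r e one by (intro wt_eqI) auto
    ultimately show "wt j i = 1 \<and> k = refl_index i j" by simp
  next
    assume "wt j i = 1 \<and> k = refl_index i j"
    then show "wt_plus_root i k j" using r(2) by (auto simp: wt_plus_root_def)
  qed
  show "refl_index i j < 27 \<and> wt (refl_index i j) i = - wt j i \<and>
    refl_index i (refl_index i j) = j \<and> wt j i \<in> {-1,0,1} \<and>
    (\<forall>k\<in>set [0..<27]. wt_plus_root i k j \<longleftrightarrow> wt j i = 1 \<and> k = refl_index i j)"
    using r(1) neg inv vals[OF j] root by auto
qed

definition refl_mat :: "nat \<Rightarrow> (nat \<Rightarrow> 'k::field) \<Rightarrow> (nat \<Rightarrow> 'k) \<Rightarrow> 'k mat" where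
  "refl_mat i a b = mat 27 27 (\<lambda>(j,k). (if k = j then a j else 0) + (if k = refl_index i j then b j else 0))"

lemma refl_mat_mult:
  assumes "i \<in> {1..6}"
  shows "refl_mat i a b * refl_mat i c d = refl_mat i (\<lambda>j. a j * c j + b j * d (refl_index i j)) (\<lambda>j. a j * d j + b j * c (refl_index i j))"
proof (rule eq_matI)
  fix j k assume "j < dim_row (refl_mat i (\<lambda>j. a j * c j + b j * d (refl_index i j)) (\<lambda>j. a j * d j + b j * c (refl_index i j)))"
   and "k < dim_col (refl_mat i (\<lambda>j. a j * c j + b j * d (refl_index i j)) (\<lambda>j. a j * d j + b j * c (refl_index i j)))"
  then have jk: "j < 27" "k < 27" by (auto simp: refl_mat_def)
  from jk assms refl_index_facts have s: "refl_index i j < 27" "refl_index i (refl_index i j) = j" by auto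
  have "(refl_mat i a b * refl_mat i c d) $$ (j,k) = (\<Sum>l\<in>{0..<27}. 
     ((if l = j then a j else 0) + (if l = refl_index i j then b j else 0)) * 
     ((if k = l then c l else 0) + (if k = refl_index i l then d l else 0)))"
    using jk by (simp add: refl_mat_def scalar_prod_def)
  also have "\<dots> = (\<Sum>l\<in>{0..<27}. (if l = j then a j * ((if k = l then c l else 0) + (if k = refl_index i l then d l else 0)) else 0))
     + (\<Sum>l\<in>{0..<27}. (if l = refl_index i j then b j * ((if k = l then c l else 0) + (if k = refl_index i l then d l else 0)) else 0))"
    unfolding sum.distrib [symmetric] by (rule sum.cong) (auto simp: algebra_simps)
  also have "\<dots> = a j * ((if k = j then c j else 0) + (if k = refl_index i j then d j else 0))
      + b j * ((if k = refl_index i j then c (refl_index i j) else 0) + (if k = refl_index i (refl_index i j) then d (refl_index i j) else 0))"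
    using jk s(1) by (simp only: sum.delta finite_atLeastLessThan) simp
  finally show "(refl_mat i a b * refl_mat i c d) $$ (j,k) = refl_mat i (\<lambda>j. a j * c j + b j * d (refl_index i j)) (\<lambda>j. a j * d j + b j * c (refl_index i j)) $$ (j,k)"
    using jk s(2) by (auto simp: refl_mat_def algebra_simps)
qed (auto simp: refl_mat_def)

lemma x_pos_refl_mat: "i \<in> {1..6} \<Longrightarrow> x_pos i t = refl_mat i (\<lambda>j. 1) (\<lambda>j. if wt j i = 1 then t else 0)"
  using refl_index_facts by (intro eq_matI) (auto simp: x_pos_def root_vec_def refl_mat_def)

lemma x_neg_refl_mat: assumes "i \<in> {1..6}" shows "x_neg i t = refl_mat i (\<lambda>j. 1) (\<lambda>j. if wt j i = -1 then t else 0)"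
proof (rule eq_matI)
  fix j k assume "j < dim_row (refl_mat i (\<lambda>j. 1) (\<lambda>j. if wt j i = -1 then t else 0))" "k < dim_col (refl_mat i (\<lambda>j. 1) (\<lambda>j. if wt j i = -1 then t else 0))"
  then have jk: "j < 27" "k < 27" by (auto simp: refl_mat_def)
  have "wt_plus_root i j k \<longleftrightarrow> wt k i = 1 \<and> j = refl_index i k" using refl_index_facts jk assms by auto
  also have "\<dots> \<longleftrightarrow> wt j i = -1 \<and> k = refl_index i j" using refl_index_facts jk assms by fastforce
  finally show "x_neg i t $$ (j,k) = refl_mat i (\<lambda>j. 1) (\<lambda>j. if wt j i = -1 then t else 0) $$ (j,k)"
    using jk by (auto simp: x_neg_def root_vec_def refl_mat_def)
qed (auto simp: refl_mat_def x_neg_def root_vec_def)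

lemma refl_mat_cong: "i \<in> {1..6} \<Longrightarrow> (\<And>j. j < 27 \<Longrightarrow> a j = c j) \<Longrightarrow> (\<And>j. j < 27 \<Longrightarrow> b j = d j) \<Longrightarrow> refl_mat i a b = refl_mat i c d"
  by (intro eq_matI) (auto simp: refl_mat_def)

lemma coroot_refl_mat: "coroot i t = refl_mat i (\<lambda>j. t powi wt j i) (\<lambda>j. 0)"
  by (intro eq_matI) (auto simp: coroot_def refl_mat_def)

lemma coroot_eq:
  assumes i: "i \<in> {1..6}" and t: "t \<noteq> 0"
  shows "coroot i t = (x_pos i t * x_neg i (- inverse t) * x_pos i t) *
     (x_pos i (-1) * x_neg i 1 * x_pos i (-1))"
  unfolding x_pos_refl_mat[OF i] x_neg_refl_mat[OF i] refl_mat_mult[OF i] coroot_refl_mat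
proof (rule refl_mat_cong[OF i], goal_cases)
  case (1 j)
  then have "wt j i \<in> {-1,0,1}" "wt (refl_index i j) i = - wt j i" "refl_index i (refl_index i j) = j" using refl_index_facts i by auto
  then show ?case using t by (auto simp: power_int_minus)
next
  case (2 j)
  then have "wt j i \<in> {-1,0,1}" "wt (refl_index i j) i = - wt j i" "refl_index i (refl_index i j) = j" using refl_index_facts i by auto
  then show ?case using t by auto
qed

lemma x_in_GL: assumes i: "i \<in> {1..6}" shows "x_pos i t \<in> carrier (GL 27)" "x_neg i t \<in> carrier (GL 27)"
proof -
  have one: "1\<^sub>m 27 = refl_mat i (\<lambda>j. 1) (\<lambda>j. 0)" by (intro eq_matI) (auto simp: refl_mat_def)
  have A: "x_pos i s * x_pos i (-s) = 1\<^sub>m 27" for s :: 'a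
    unfolding x_pos_refl_mat[OF i] refl_mat_mult[OF i] one
  proof (rule refl_mat_cong[OF i], goal_cases)
    case (1 j)
    then have "wt j i \<in> {-1,0,1}" "wt (refl_index i j) i = - wt j i" "refl_index i (refl_index i j) = j" using refl_index_facts i by auto
    then show ?case by auto
  next
    case (2 j) then show ?case by auto
  qed
  have B: "x_neg i s * x_neg i (-s) = 1\<^sub>m 27" for s :: 'a
    unfolding x_neg_refl_mat[OF i] refl_mat_mult[OF i] one
  proof (rule refl_mat_cong[OF i], goal_cases)
    case (1 j)
    then have "wt j i \<in> {-1,0,1}" "wt (refl_index i j) i = - wt j i" "refl_index i (refl_index i j) = j" using refl_index_facts i by auto
    then show ?case by auto
  next
    case (2 j) then show ?case by auto
  qed
  have c: "x_pos i s \<in> carrier_mat 27 27" "x_neg i s \<in> carrier_mat 27 27" for s :: 'a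
    by (auto simp: x_pos_def x_neg_def root_vec_def)
  show "x_pos i t \<in> carrier (GL 27)" using A[of t] A[of "-t"] c(1)[of t] c(1)[of "-t"]
    by (auto simp: GL_def units_of_def Units_def ring_mat_simps)
  show "x_neg i t \<in> carrier (GL 27)" using B[of t] B[of "-t"] c(2)[of t] c(2)[of "-t"]
    by (auto simp: GL_def units_of_def Units_def ring_mat_simps)
qed

lemma coroot_in_E6: assumes i: "i \<in> {1..6}" and t: "t \<noteq> 0" shows "coroot i t \<in> carrier E6"
proof -
  let ?S = "\<Union>i\<in>{1..6}. range (x_pos i) \<union> range (x_neg i) :: 'a mat set"
  have m: "A * B \<in> generate (GL 27) ?S" if "A \<in> generate (GL 27) ?S" "B \<in> generate (GL 27) ?S" for A B :: "'a mat"
    using generate.eng[OF that] by (simp add: GL_def units_of_def ring_mat_simps)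
  have x: "x_pos i s \<in> generate (GL 27) ?S" "x_neg i s \<in> generate (GL 27) ?S" for s
    using i by (auto intro!: generate.incl)
  have "coroot i t \<in> generate (GL 27) ?S"
    unfolding coroot_eq[OF i t] by (intro m x)
  then show ?thesis by (simp add: E6_def)
qed

lemma group_GL: "group (GL n :: 'k::field mat monoid)"
proof -
  interpret semiring "ring_mat TYPE('k) n ()" by (rule semiring_mat)
  show ?thesis unfolding GL_def by (rule units_group)
qed

lemma group_E6: "group (E6 :: 'k::field mat monoid)"
proof -
  interpret group "GL 27 :: 'k mat monoid" by (rule group_GL)
  show ?thesis unfolding E6_def
    by (intro subgroup.subgroup_is_group generate_is_subgroup group_GL) (auto intro: x_in_GL)
qed

lemma levi_subgroup_E6: "subgroup (carrier levi) (E6 :: 'k::field mat monoid)"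
proof -
  interpret group "E6 :: 'k mat monoid" by (rule group_E6)
  have m: "A * B \<in> carrier E6" if "A \<in> carrier E6" "B \<in> carrier E6" for A B :: "'k mat"
    using m_closed[OF that] by (simp add: E6_def GL_def units_of_def ring_mat_simps)
  have "torus_elt t \<in> carrier E6" if "\<forall>i\<in>{1..6}. t i \<noteq> 0" for t :: "nat \<Rightarrow> 'k"
    unfolding torus_elt_def using that by (intro m coroot_in_E6) auto
  moreover have x: "x_pos i t \<in> carrier E6" "x_neg i t \<in> carrier E6" if "i \<in> {1..6}" for i and t :: 'k
    using that by (auto simp: E6_def intro!: generate.incl)
  moreover have "i \<in> {1..6}" if "i \<in> {1,3,4,5,6}" for i :: nat
    using that by auto
  ultimately have "torus \<union> (\<Union>i\<in>{1,3,4,5,6}. range (x_pos i) \<union> range (x_neg i)) \<subseteq> (carrier E6 :: 'k mat set)"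
    unfolding torus_def by blast
  then show ?thesis
    unfolding levi_def using generate_is_subgroup by simp
qed

end

theory Submission
  imports Defs
begin

text \<open>
  The Levi subgroup \<open>M\<close> is the product of its central torus \<open>A\<^sub>M = {\<gamma>\<^sub>0\<^sup>\<vee>(t)}\<close> and its derived group
  \<open>M\<^sub>D\<close>, and on such a product both sides of the identity can be read off: writing
  \<open>m = \<gamma>\<^sub>0\<^sup>\<vee>(t) d\<close> with \<open>d \<in> M\<^sub>D\<close>, a character of \<open>M\<close> is trivial on \<open>d\<close>, so that
  \<open>\<gamma>\<^sub>0(m) = \<gamma>\<^sub>0(\<gamma>\<^sub>0\<^sup>\<vee>(t)) = t\<^bsup>\<langle>\<gamma>\<^sub>0,\<gamma>\<^sub>0\<^sup>\<vee>\<rangle>\<^esup> = t\<^sup>2\<close> (\<open>gamma0_character_value\<close>), while the first component of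
  \<open>\<xi>(m)\<close> is \<open>t\<^sup>2\<close> by construction.

  Two points need an argument. The first is the decomposition \<open>M = A\<^sub>M M\<^sub>D\<close>
  (\<open>levi_decomposition\<close>). The torus elements \<open>\<gamma>\<^sub>0\<^sup>\<vee>(t)\<close> are central, since
  \<open>\<langle>\<alpha>\<^sub>i,\<gamma>\<^sub>0\<^sup>\<vee>\<rangle> = 0\<close> for \<open>i \<noteq> 2\<close>; the root subgroups of \<open>\<plusminus>\<alpha>\<^sub>i\<close>, \<open>i \<noteq> 2\<close>, consist of commutators with torus
  elements; and an element of the maximal torus is brought into \<open>M\<^sub>D\<close> by dividing it by \<open>\<gamma>\<^sub>0\<^sup>\<vee>(s)\<close>,
  where \<open>s\<^sup>2\<close> is its \<open>\<alpha>\<^sub>2\<^sup>\<vee>\<close>-coordinate, because \<open>\<alpha>\<^sub>2\<^sup>\<vee>\<close> occurs in \<open>\<gamma>\<^sub>0\<^sup>\<vee>\<close> with coefficient 2. The square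
  root exists since the base field is algebraically closed.

  The second is that \<open>\<xi>\<close> is well defined (\<open>xi_gamma0_coroot_mult\<close>). If
  \<open>\<gamma>\<^sub>0\<^sup>\<vee>(t) \<phi>(x) = \<gamma>\<^sub>0\<^sup>\<vee>(s) \<phi>(y)\<close>, then applying the character \<open>\<gamma>\<^sub>0\<close> gives \<open>t\<^sup>2 = s\<^sup>2\<close>, so \<open>s = \<plusminus>t\<close>; the sign is
  absorbed by \<open>\<gamma>\<^sub>0\<^sup>\<vee>(-1) = \<alpha>\<^sub>1\<^sup>\<vee>(-1) \<alpha>\<^sub>4\<^sup>\<vee>(-1) \<alpha>\<^sub>6\<^sup>\<vee>(-1) = \<phi>(-1)\<close>.
\<close>

section \<open>The torus\<close>

lemma prod_upto_6:
  fixes f :: "nat \<Rightarrow> 'a::comm_monoid_mult"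
  shows "(\<Prod>i\<in>{1..6}. f i) = f 1 * f 2 * f 3 * f 4 * f 5 * f 6"
proof -
  have "{1..6::nat} = {1,2,3,4,5,6}" by auto
  then show ?thesis by (simp add: mult.assoc)
qed

lemma coroot_mat_diag: "coroot i t = mat_diag 27 (\<lambda>j. t powi wt j i)"
  by (auto simp: coroot_def mat_diag_def)

lemma torus_elt_mat_diag: "torus_elt t = mat_diag 27 (\<lambda>j. \<Prod>i\<in>{1..6}. t i powi wt j i)"
  unfolding torus_elt_def coroot_mat_diag mat_diag_diag prod_upto_6 ..

lemma torus_elt_cong:
  "(\<And>i. i \<in> {1..6} \<Longrightarrow> s i = t i) \<Longrightarrow> torus_elt s = torus_elt t"
  unfolding torus_elt_mat_diag by simp

lemma torus_elt_mult: "torus_elt s * torus_elt t = torus_elt (\<lambda>i. s i * t i)"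
  by (simp add: torus_elt_mat_diag mat_diag_diag power_int_mult_distrib prod.distrib)

lemma torus_elt_one: "torus_elt (\<lambda>i. 1) = 1\<^sub>m 27"
  by (simp add: torus_elt_mat_diag)

text \<open>
  The relation \<open>h x\<^bsub>\<alpha>\<^esub>(u) h\<^sup>-\<^sup>1 = x\<^bsub>\<alpha>\<^esub>(\<alpha>(h) u)\<close>, with \<open>\<alpha>\<^sub>i(h) = \<Prod>\<^sub>l t\<^sub>l\<^bsup>\<langle>\<alpha>\<^sub>i,\<alpha>\<^sub>l\<^sup>\<vee>\<rangle>\<^esup>\<close>: the only off-diagonal entries
  of \<open>x\<^bsub>\<alpha>\<^esub>(u)\<close> join weights that differ by \<open>\<alpha>\<close>, so the two diagonal entries of \<open>h\<close> involved have
  quotient \<open>\<alpha>(h)\<close>. It yields both that \<open>\<gamma>\<^sub>0\<^sup>\<vee>(t)\<close> is central in the Levi subgroup and that root elements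
  are commutators.
\<close>

lemma torus_elt_conj_x_pos:
  assumes t: "\<And>l. l \<in> {1..6} \<Longrightarrow> t l \<noteq> 0"
  shows "torus_elt t * x_pos i u = x_pos i ((\<Prod>l\<in>{1..6}. t l powi cartan i l) * u) * torus_elt t"
    (is "_ = x_pos i (?a * u) * _")
proof -
  let ?d = "\<lambda>j. \<Prod>l\<in>{1..6}. t l powi wt j l"
  have root: "?d j = ?a * ?d k" if "wt_plus_root i k j" for j k
    unfolding prod.distrib[symmetric]
  proof (rule prod.cong)
    fix l :: nat assume l: "l \<in> {1..6}"
    then have "wt j l = cartan i l + wt k l" using that by (auto simp: wt_plus_root_def)
    then show "t l powi wt j l = t l powi cartan i l * t l powi wt k l"
      using t[OF l] by (simp add: power_int_add)
  qed simp
  have c: "x_pos i w \<in> carrier_mat 27 27" for w :: 'a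
    by (auto simp: x_pos_def root_vec_def)
  show ?thesis
    unfolding torus_elt_mat_diag mat_diag_mult_left[OF c] mat_diag_mult_right[OF c]
  proof (rule eq_matI, goal_cases)
    case (1 j k)
    then have jk: "j < 27" "k < 27" by (simp_all add: x_pos_def root_vec_def)
    \<comment> \<open>For \<open>i\<close> outside \<open>1, \<dots>, 6\<close> the condition \<open>\<mu>\<^sub>j = \<mu>\<^sub>k + \<alpha>\<^sub>i\<close> degenerates to \<open>\<mu>\<^sub>j = \<mu>\<^sub>k\<close>, so the identity and
      root vector parts of the entry may overlap; the sum form covers this too.\<close>
    let ?\<delta> = "if j = k then 1 else 0 :: 'a" and ?\<rho> = "if wt_plus_root i k j then 1 else 0 :: 'a"
    have x: "x_pos i w $$ (j, k) = ?\<delta> + w * ?\<rho>" for w :: 'a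
      using jk by (simp add: x_pos_def root_vec_def)
    have "?d j * ?\<delta> = ?\<delta> * ?d k" "?d j * ?\<rho> = ?a * ?\<rho> * ?d k"
      using root[where j = j and k = k] by (auto simp del: One_nat_def)
    then have "?d j * (?\<delta> + u * ?\<rho>) = (?\<delta> + ?a * u * ?\<rho>) * ?d k"
      by (simp only: distrib_left distrib_right mult.assoc mult.left_commute[of _ u])
    then have "?d j * x_pos i u $$ (j, k) = x_pos i (?a * u) $$ (j, k) * ?d k"
      unfolding x .
    then show ?case using jk by (simp del: One_nat_def)
  qed (simp_all add: x_pos_def root_vec_def)
qed

text \<open>
  The transpose of the previous relation; the root character is on the other side because
  transposition reverses products.
\<close>

lemma torus_elt_conj_x_neg:
  assumes t: "\<And>l. l \<in> {1..6} \<Longrightarrow> t l \<noteq> 0"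
  shows "x_neg i u * torus_elt t = torus_elt t * x_neg i ((\<Prod>l\<in>{1..6}. t l powi cartan i l) * u)"
    (is "_ = _ * x_neg i (?a * u)")
proof -
  have T: "transpose_mat (torus_elt t) = torus_elt t"
    by (auto simp: torus_elt_mat_diag mat_diag_def)
  have x: "transpose_mat (x_pos i w) = x_neg i w" for w :: 'a
    by (rule eq_matI) (auto simp: x_pos_def x_neg_def root_vec_def)
  have c: "x_pos i w \<in> carrier_mat 27 27" "torus_elt t \<in> carrier_mat 27 27" for w :: 'a
    by (auto simp: x_pos_def root_vec_def torus_elt_mat_diag)
  have "transpose_mat (torus_elt t * x_pos i u) = transpose_mat (x_pos i (?a * u) * torus_elt t)"
    by (subst torus_elt_conj_x_pos[OF t]) auto
  then show ?thesis
    by (simp add: transpose_mult[OF c(2) c(1)] transpose_mult[OF c(1) c(2)] T x)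
qed

text \<open>
  \<open>e\<^sub>i\<close> raises \<open>\<langle>\<mu>,\<alpha>\<^sub>i\<^sup>\<vee>\<rangle>\<close> from \<open>-1\<close> to \<open>1\<close>, so it cannot be applied twice: the term in \<open>s t\<close> vanishes.
\<close>

lemma x_pos_add:
  assumes "i \<in> {1..6}"
  shows "x_pos i s * x_pos i t = x_pos i (s + t)"
  unfolding x_pos_refl_mat[OF assms] refl_mat_mult[OF assms]
proof (rule refl_mat_cong[OF assms])
  fix j :: nat assume "j < 27"
  then have "wt (refl_index i j) i = - wt j i" using refl_index_facts assms by auto
  then show "1 * 1 + (if wt j i = 1 then s else 0) *
      (if wt (refl_index i j) i = 1 then t else 0) = 1" by auto
qed auto

lemma x_neg_add:
  assumes "i \<in> {1..6}"
  shows "x_neg i s * x_neg i t = x_neg i (s + t)"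
  unfolding x_neg_refl_mat[OF assms] refl_mat_mult[OF assms]
proof (rule refl_mat_cong[OF assms])
  fix j :: nat assume "j < 27"
  then have "wt (refl_index i j) i = - wt j i" using refl_index_facts assms by auto
  then show "1 * 1 + (if wt j i = -1 then s else 0) *
      (if wt (refl_index i j) i = -1 then t else 0) = 1" by auto
qed auto

section \<open>The coroot of the highest root\<close>

lemma prod_power_int_eq_power_int_sum:
  fixes t :: "'a::field"
  assumes "t \<noteq> 0"
  shows "(\<Prod>i\<in>A. (t powi c i) powi d i) = t powi (\<Sum>i\<in>A. c i * d i)"
  by (induction A rule: infinite_finite_induct)
    (auto simp: power_int_mult [symmetric] power_int_add assms)

text \<open>
  The highest root is \<open>\<omega>\<^sub>2\<close>: it is orthogonal to all simple roots except \<open>\<alpha>\<^sub>2\<close>, the node to which the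
  affine node is attached in the extended Dynkin diagram.
\<close>

lemma gamma0_pairing_values: "gamma0_pairing 2 = 1" "i \<in> {1,3,4,5,6} \<Longrightarrow> gamma0_pairing i = 0"
proof -
  have "{1..6::nat} = {1,2,3,4,5,6}" by auto
  then show "gamma0_pairing 2 = 1" "i \<in> {1,3,4,5,6} \<Longrightarrow> gamma0_pairing i = 0"
    by (auto simp: gamma0_pairing_def gamma0_coeff_def cartan_def)
qed

lemma gamma0_coroot_mult: "gamma0_coroot s * gamma0_coroot t = gamma0_coroot (s * t)"
  by (simp add: gamma0_coroot_def torus_elt_mult power_int_mult_distrib)

lemma gamma0_coroot_one: "gamma0_coroot 1 = 1\<^sub>m 27"
  by (simp add: gamma0_coroot_def torus_elt_one)

text \<open>
  The value \<open>\<alpha>\<^sub>i(\<gamma>\<^sub>0\<^sup>\<vee>(t)) = t\<^bsup>\<langle>\<alpha>\<^sub>i,\<gamma>\<^sub>0\<^sup>\<vee>\<rangle>\<^esup>\<close>. The exponent is \<open>\<langle>\<gamma>\<^sub>0,\<alpha>\<^sub>i\<^sup>\<vee>\<rangle>\<close> because the Cartan matrix is symmetric and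
  \<open>\<gamma>\<^sub>0\<close>, \<open>\<gamma>\<^sub>0\<^sup>\<vee>\<close> have the same coefficients.
\<close>

lemma root_at_gamma0_coroot:
  fixes t :: "'k::field"
  assumes "t \<noteq> 0" "i \<in> {1,3,4,5,6}"
  shows "(\<Prod>l\<in>{1..6}. (t powi gamma0_coeff l) powi cartan i l) = 1"
proof -
  have "cartan i l = cartan l i" for l by (auto simp: cartan_def)
  then have "(\<Sum>l\<in>{1..6}. gamma0_coeff l * cartan i l) = gamma0_pairing i"
    by (simp add: gamma0_pairing_def)
  then show ?thesis
    using gamma0_pairing_values(2)[OF assms(2)]
    by (simp add: prod_power_int_eq_power_int_sum[OF assms(1)])
qed

lemma gamma0_at_gamma0_coroot:
  fixes t :: "'k::field"
  assumes "t \<noteq> 0"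
  shows "(\<Prod>i\<in>{1..6}. (t powi gamma0_coeff i) powi gamma0_pairing i) = t ^ 2"
proof -
  have "{1..6::nat} = {1,2,3,4,5,6}" by auto
  then have "(\<Sum>i\<in>{1..6}. gamma0_coeff i * gamma0_pairing i) = 2"
    using gamma0_pairing_values by (simp add: gamma0_coeff_def)
  then show ?thesis by (simp add: prod_power_int_eq_power_int_sum[OF assms])
qed

section \<open>The Levi subgroup and its derived group\<close>

lemma levi_simps:
  "A \<otimes>\<^bsub>levi\<^esub> B = A * B" "\<one>\<^bsub>levi\<^esub> = 1\<^sub>m 27"
  "A \<otimes>\<^bsub>levi_der\<^esub> B = A * B"
  by (simp_all add: levi_def levi_der_def E6_def GL_def units_of_def ring_mat_simps)

lemma SL_simps: "A \<otimes>\<^bsub>SL n\<^esub> B = A * B"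
  by (simp add: SL_def GL_def units_of_def ring_mat_simps)

lemma group_levi: "group (levi :: 'k::field mat monoid)"
proof -
  have "levi = (E6 :: 'k mat monoid)\<lparr>carrier := carrier levi\<rparr>" by (simp add: levi_def)
  then show ?thesis
    using subgroup.subgroup_is_group[OF levi_subgroup_E6 group_E6] by metis
qed

lemma torus_elt_in_levi:
  "(\<And>i. i \<in> {1..6} \<Longrightarrow> t i \<noteq> 0) \<Longrightarrow> torus_elt t \<in> carrier levi"
  by (auto simp: levi_def torus_def intro!: generate.incl)

lemma x_in_levi:
  assumes "i \<in> {1,3,4,5,6}"
  shows "x_pos i u \<in> carrier levi" "x_neg i u \<in> carrier levi"
  unfolding levi_def using assms by (auto intro!: generate.incl)

lemma levi_carrier_mat: "A \<in> carrier levi \<Longrightarrow> A \<in> carrier_mat 27 27"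
proof -
  assume "A \<in> carrier levi"
  then have "A \<in> carrier E6" using subgroup.subset[OF levi_subgroup_E6] by blast
  moreover have "carrier E6 \<subseteq> carrier (GL 27)"
    by (simp add: E6_def) (rule group.generate_incl[OF group_GL], auto intro: x_in_GL)
  ultimately have "A \<in> carrier (GL 27)" by blast
  then show ?thesis by (simp add: GL_def units_of_def Units_def ring_mat_simps)
qed

lemma subgroup_levi_der: "subgroup (carrier levi_der) (levi :: 'k::field mat monoid)"
  unfolding levi_der_def using group.derived_is_subgroup[OF group_levi order_refl] by simp

text \<open>
  A commutator criterion free of inverses: it asks for \<open>A B A\<^sup>-\<^sup>1 = C B\<close>, the form in which the relations
  between torus and root elements are available.
\<close>

lemma commutator_in_levi_der:
  assumes A: "A \<in> carrier levi" and B: "B \<in> carrier levi" and B': "B' \<in> carrier levi"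
    and C: "C \<in> carrier levi" and AB: "A * B = B' * A" and B'_eq: "B' = C * B"
  shows "C \<in> carrier (levi_der :: 'k::field mat monoid)"
proof -
  interpret group "levi :: 'k mat monoid" by (rule group_levi)
  have "A \<otimes>\<^bsub>levi\<^esub> B \<otimes>\<^bsub>levi\<^esub> inv\<^bsub>levi\<^esub> A \<otimes>\<^bsub>levi\<^esub> inv\<^bsub>levi\<^esub> B = C"
  proof -
    have "A \<otimes>\<^bsub>levi\<^esub> B \<otimes>\<^bsub>levi\<^esub> inv\<^bsub>levi\<^esub> A = C \<otimes>\<^bsub>levi\<^esub> B"
      using AB B'_eq A B B' C by (simp flip: levi_simps add: m_assoc)
    then show ?thesis using B C by (simp add: m_assoc)
  qed
  then have "C \<in> derived levi (carrier levi)"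
    unfolding derived_def using A B by (auto intro!: generate.incl)
  then show ?thesis by (simp add: levi_der_def)
qed

text \<open>
  For \<open>h = \<alpha>\<^sub>i\<^sup>\<vee>(2)\<close> one has \<open>\<alpha>\<^sub>i(h) = 2\<^sup>2 = 4\<close>, hence \<open>h x(w) h\<^sup>-\<^sup>1 x(w)\<^sup>-\<^sup>1 = x(3 w)\<close> in the root subgroup of
  \<open>\<alpha>\<^sub>i\<close>, and 3 is invertible.
\<close>

lemma x_in_levi_der:
  fixes u :: "'k::field_char_0"
  assumes i: "i \<in> {1,3,4,5,6}"
  shows "x_pos i u \<in> carrier levi_der" "x_neg i u \<in> carrier levi_der"
proof -
  have i6: "i \<in> {1..6}" using i by auto
  define h :: "nat \<Rightarrow> 'k" where "h l = (if l = i then 2 else 1)" for l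
  have h: "h l \<noteq> 0" for l by (simp add: h_def)
  have "(\<Prod>l\<in>{1..6}. h l powi cartan i l) = (\<Prod>l\<in>{1..6}. if l = i then 4 else 1)"
    by (rule prod.cong) (auto simp: h_def cartan_def)
  also have "\<dots> = 4" using i6 by simp
  finally have four: "(\<Prod>l\<in>{1..6}. h l powi cartan i l) = 4" .
  show "x_pos i u \<in> carrier levi_der"
  proof (rule commutator_in_levi_der)
    show "torus_elt h * x_pos i (u / 3) = x_pos i (4 * (u / 3)) * torus_elt h"
      using torus_elt_conj_x_pos[of h i "u / 3"] h four by simp
    show "x_pos i (4 * (u / 3)) = x_pos i u * x_pos i (u / 3)"
      by (simp add: x_pos_add[OF i6] field_simps)
  qed (use i h in \<open>auto intro!: torus_elt_in_levi x_in_levi\<close>)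
  \<comment> \<open>On \<open>x\<^bsub>-\<alpha>\<^sub>i\<^esub>\<close> conjugation by \<open>h\<close> divides by 4, whence the commutator of \<open>h\<close> with \<open>x\<^bsub>-\<alpha>\<^sub>i\<^esub>(w)\<close> has
    parameter \<open>-3 w / 4\<close>.\<close>
  show "x_neg i u \<in> carrier levi_der"
  proof (rule commutator_in_levi_der)
    show "torus_elt h * x_neg i (- 4 * u / 3) = x_neg i (- u / 3) * torus_elt h"
      using torus_elt_conj_x_neg[of h i "- u / 3"] h four by simp
    show "x_neg i (- u / 3) = x_neg i u * x_neg i (- 4 * u / 3)"
      by (simp add: x_neg_add[OF i6] field_simps)
  qed (use i h in \<open>auto intro!: torus_elt_in_levi x_in_levi\<close>)
qed

lemma levi_der_mult:
  fixes A B :: "'k::field mat"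
  assumes "A \<in> carrier levi_der" "B \<in> carrier levi_der"
  shows "A * B \<in> carrier levi_der"
  using subgroup.m_closed[OF subgroup_levi_der assms] by (simp add: levi_simps)

lemma coroot_in_levi_der:
  fixes t :: "'k::field_char_0"
  assumes i: "i \<in> {1,3,4,5,6}" and t: "t \<noteq> 0"
  shows "coroot i t \<in> carrier levi_der"
proof -
  have "i \<in> {1..6}" using i by auto
  from coroot_eq[OF this t] show ?thesis
    by (simp add: levi_der_mult x_in_levi_der[OF i])
qed

lemma gamma0_coroot_in_levi: "t \<noteq> 0 \<Longrightarrow> gamma0_coroot t \<in> carrier levi"
  unfolding gamma0_coroot_def by (rule torus_elt_in_levi) simp

abbreviation levi_generators :: "'k::field mat set" where
  "levi_generators \<equiv> torus \<union> (\<Union>i\<in>{1,3,4,5,6}. range (x_pos i) \<union> range (x_neg i))"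

lemma levi_generator_cases [consumes 1, case_names torus x_pos x_neg]:
  assumes "B \<in> levi_generators"
  obtains t where "\<And>i. i \<in> {1..6} \<Longrightarrow> t i \<noteq> 0" "B = torus_elt t"
    | i u where "i \<in> {1,3,4,5,6}" "B = x_pos i u"
    | i u where "i \<in> {1,3,4,5,6}" "B = x_neg i u"
  using assms
proof (elim UnE UN_E rangeE)
  assume "B \<in> torus"
  then show thesis using that(1) unfolding torus_def by blast
qed (use that in blast)+

text \<open>
  Generation inside \<open>levi\<close> itself rather than \<open>E6\<close>, so that inductions over generated elements
  use the inverses of the group in which the rest of the argument takes place.
\<close>

lemma levi_generated:
  "carrier (levi :: 'k::field mat monoid) = generate levi levi_generators"
proof -
  have "generate E6 levi_generators
      = generate (E6\<lparr>carrier := carrier (levi :: 'k mat monoid)\<rparr>) levi_generators"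
    by (rule group.generate_consistent[OF group_E6 _ levi_subgroup_E6, symmetric])
      (auto simp: torus_def intro!: torus_elt_in_levi x_in_levi)
  moreover have "E6\<lparr>carrier := carrier (levi :: 'k mat monoid)\<rparr> = levi"
    by (simp add: levi_def)
  ultimately show ?thesis by (simp add: levi_def)
qed

text \<open>
  It suffices to check the generators: the torus is commutative, and \<open>\<gamma>\<^sub>0\<^sup>\<vee>(t)\<close> commutes with the root
  elements because the roots of \<open>M\<close> are trivial on it.
\<close>

lemma gamma0_coroot_central:
  fixes t :: "'k::field"
  assumes t: "t \<noteq> 0" and A: "A \<in> carrier levi"
  shows "gamma0_coroot t * A = A * gamma0_coroot t"
proof -
  interpret group "levi :: 'k mat monoid" by (rule group_levi)
  note g = gamma0_coroot_in_levi[OF t]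
  have gen: "gamma0_coroot t * B = B * gamma0_coroot t" if "B \<in> levi_generators" for B
    using that
  proof (cases rule: levi_generator_cases)
    case torus
    then show ?thesis by (simp add: gamma0_coroot_def torus_elt_mult mult.commute)
  next
    case (x_pos i u)
    then show ?thesis
      using torus_elt_conj_x_pos[of "\<lambda>l. t powi gamma0_coeff l" i u]
      unfolding gamma0_coroot_def root_at_gamma0_coroot[OF t x_pos(1)] by (simp add: t)
    next
    case (x_neg i u)
    then show ?thesis
      using torus_elt_conj_x_neg[of "\<lambda>l. t powi gamma0_coeff l" i u]
      unfolding gamma0_coroot_def root_at_gamma0_coroot[OF t x_neg(1)] by (simp add: t)
  qed
  have S: "levi_generators \<subseteq> carrier levi"
    by (auto simp: torus_def intro!: torus_elt_in_levi x_in_levi)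
  from A have "A \<in> generate levi levi_generators" by (subst (asm) levi_generated)
  then have "A \<in> carrier levi \<and> gamma0_coroot t \<otimes>\<^bsub>levi\<^esub> A = A \<otimes>\<^bsub>levi\<^esub> gamma0_coroot t"
    (is "_ \<and> ?comm A")
  proof (induction A rule: generate.induct)
    case one
    show ?case using g by simp
  next
    case (incl h)
    then show ?case using S gen[of h] by (auto simp: levi_simps)
  next
    case (inv h)
    then have h: "h \<in> carrier levi" and c: "?comm h" using S gen[of h] by (auto simp: levi_simps)
    have "gamma0_coroot t \<otimes>\<^bsub>levi\<^esub> inv\<^bsub>levi\<^esub> h
        = inv\<^bsub>levi\<^esub> h \<otimes>\<^bsub>levi\<^esub> (h \<otimes>\<^bsub>levi\<^esub> gamma0_coroot t) \<otimes>\<^bsub>levi\<^esub> inv\<^bsub>levi\<^esub> h"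
      using h g by (simp add: m_assoc inv_solve_left)
    also have "\<dots> = inv\<^bsub>levi\<^esub> h \<otimes>\<^bsub>levi\<^esub> gamma0_coroot t"
      using h g by (simp flip: c add: m_assoc)
    finally show ?case using h by simp
  next
    case (eng h1 h2)
    then have h: "h1 \<in> carrier levi" "h2 \<in> carrier levi" and c: "?comm h1" "?comm h2"
      by auto
    have "gamma0_coroot t \<otimes>\<^bsub>levi\<^esub> (h1 \<otimes>\<^bsub>levi\<^esub> h2)
        = h1 \<otimes>\<^bsub>levi\<^esub> (gamma0_coroot t \<otimes>\<^bsub>levi\<^esub> h2)"
      using h g c(1) by (simp flip: m_assoc)
    also have "\<dots> = h1 \<otimes>\<^bsub>levi\<^esub> h2 \<otimes>\<^bsub>levi\<^esub> gamma0_coroot t"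
      using h g c(2) by (simp add: m_assoc)
    finally show ?case using h by simp
  qed
  then show ?thesis by (simp add: levi_simps)
qed

text \<open>
  Dividing by \<open>\<gamma>\<^sub>0\<^sup>\<vee>(s)\<close> with \<open>s\<^sup>2 = t\<^sub>2\<close> removes the factor \<open>\<alpha>\<^sub>2\<^sup>\<vee>(t\<^sub>2)\<close>, the only one outside the derived
  group.
\<close>

lemma torus_elt_decomposition:
  fixes t :: "nat \<Rightarrow> 'k::{alg_closed_field, field_char_0}"
  assumes t: "\<And>i. i \<in> {1..6} \<Longrightarrow> t i \<noteq> 0"
  shows "\<exists>s d. s \<noteq> 0 \<and> d \<in> carrier levi_der \<and> torus_elt t = gamma0_coroot s * d"
proof -
  obtain s where s: "s ^ 2 = t 2" using nth_root_exists[of 2 "t 2"] by auto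
  have s0: "s \<noteq> 0" using s t[of 2] by auto
  define r where "r i = t i * inverse (s powi gamma0_coeff i)" for i
  have r0: "r i \<noteq> 0" if "i \<in> {1..6}" for i using t[OF that] s0 by (simp add: r_def)
  have "s powi gamma0_coeff 2 = t 2" using s by (simp add: gamma0_coeff_def)
  then have r2: "r 2 = 1" using t[of 2] by (simp add: r_def)
  have id: "coroot 2 (1::'k) = 1\<^sub>m 27" by (simp add: coroot_mat_diag)
  have c: "coroot 1 u * 1\<^sub>m 27 = coroot 1 u" for u :: 'k
    by (rule right_mult_one_mat[of _ 27 27]) (simp add: coroot_def)
  have "torus_elt r \<in> carrier levi_der"
    unfolding torus_elt_def r2 id c by (intro levi_der_mult coroot_in_levi_der r0) simp_all
  moreover have "torus_elt t = gamma0_coroot s * torus_elt r"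
    unfolding gamma0_coroot_def torus_elt_mult
    by (rule torus_elt_cong) (simp add: r_def s0)
  ultimately show ?thesis using s0 by blast
qed

text \<open>
  The generators lie in \<open>A\<^sub>M M\<^sub>D\<close>, and this product set is closed under products and inverses because
  \<open>A\<^sub>M\<close> is central.
\<close>

lemma levi_decomposition:
  fixes m :: "'k::{alg_closed_field, field_char_0} mat"
  assumes "m \<in> carrier levi"
  shows "\<exists>s d. s \<noteq> 0 \<and> d \<in> carrier levi_der \<and> m = gamma0_coroot s * d"
proof -
  interpret group "levi :: 'k mat monoid" by (rule group_levi)
  interpret D: subgroup "carrier levi_der" "levi :: 'k mat monoid" by (rule subgroup_levi_der)
  let ?P = "\<lambda>A. \<exists>s d. s \<noteq> 0 \<and> d \<in> carrier levi_der \<and> A = gamma0_coroot s \<otimes>\<^bsub>levi\<^esub> d"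
  have g: "gamma0_coroot s \<in> carrier levi" if "s \<noteq> 0" for s :: 'k
    using that by (rule gamma0_coroot_in_levi)
  have comm: "gamma0_coroot s \<otimes>\<^bsub>levi\<^esub> A = A \<otimes>\<^bsub>levi\<^esub> gamma0_coroot s"
    if "s \<noteq> 0" "A \<in> carrier levi" for s :: 'k and A
    using gamma0_coroot_central[OF that] by (simp add: levi_simps)
  have gmult: "gamma0_coroot s \<otimes>\<^bsub>levi\<^esub> gamma0_coroot t = gamma0_coroot (s * t)" for s t :: 'k
    by (simp add: levi_simps gamma0_coroot_mult)
  have gone: "gamma0_coroot (1::'k) = \<one>\<^bsub>levi\<^esub>" by (simp add: levi_simps gamma0_coroot_one)
  have der: "?P A" if "A \<in> carrier levi_der" for A :: "'k mat"
    using that D.subset by (intro exI[of _ 1] exI[of _ A]) (auto simp: gone)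
  have gen: "?P A" if "A \<in> levi_generators" for A :: "'k mat"
    using that
  proof (cases rule: levi_generator_cases)
    case (torus t)
    then show ?thesis using torus_elt_decomposition[of t] by (simp add: levi_simps)
  next
    case (x_pos i u)
    then show ?thesis using der[OF x_in_levi_der(1)] by blast
  next
    case (x_neg i u)
    then show ?thesis using der[OF x_in_levi_der(2)] by blast
  qed
  have "m \<in> generate levi levi_generators" using assms by (subst (asm) levi_generated)
  then have "?P m"
  proof (induction m rule: generate.induct)
    case one
    show ?case by (rule der) simp
  next
    case (incl h)
    then show ?case by (rule gen)
  next
    case (inv h)
    from gen[OF inv(1)] obtain s d where s: "s \<noteq> 0" and d: "d \<in> carrier levi_der"
      and h: "h = gamma0_coroot s \<otimes>\<^bsub>levi\<^esub> d" by blast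
    have "inv\<^bsub>levi\<^esub> gamma0_coroot s = gamma0_coroot (inverse s)"
      by (rule inv_equality) (use s in \<open>auto simp: gmult gone g\<close>)
    moreover have dl: "d \<in> carrier levi" using d D.subset by blast
    ultimately have "inv\<^bsub>levi\<^esub> h = inv\<^bsub>levi\<^esub> d \<otimes>\<^bsub>levi\<^esub> gamma0_coroot (inverse s)"
      using s g unfolding h by (subst inv_mult_group) simp_all
    also have "\<dots> = gamma0_coroot (inverse s) \<otimes>\<^bsub>levi\<^esub> inv\<^bsub>levi\<^esub> d"
      using s dl by (simp add: comm)
    finally have "inv\<^bsub>levi\<^esub> h = gamma0_coroot (inverse s) \<otimes>\<^bsub>levi\<^esub> inv\<^bsub>levi\<^esub> d" .
    then show ?case using s d by (intro exI[of _ "inverse s"] exI[of _ "inv\<^bsub>levi\<^esub> d"]) simp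
  next
    case (eng h1 h2)
    then obtain s1 d1 s2 d2 where s: "s1 \<noteq> 0" "s2 \<noteq> 0"
      and d: "d1 \<in> carrier levi_der" "d2 \<in> carrier levi_der"
      and h: "h1 = gamma0_coroot s1 \<otimes>\<^bsub>levi\<^esub> d1" "h2 = gamma0_coroot s2 \<otimes>\<^bsub>levi\<^esub> d2" by blast
    have dl: "d1 \<in> carrier levi" "d2 \<in> carrier levi" using d D.subset by auto
    have "h1 \<otimes>\<^bsub>levi\<^esub> h2
        = gamma0_coroot s1 \<otimes>\<^bsub>levi\<^esub> (d1 \<otimes>\<^bsub>levi\<^esub> gamma0_coroot s2) \<otimes>\<^bsub>levi\<^esub> d2"
      using s dl g by (simp add: h m_assoc)
    also have "\<dots> = gamma0_coroot s1 \<otimes>\<^bsub>levi\<^esub> gamma0_coroot s2 \<otimes>\<^bsub>levi\<^esub> (d1 \<otimes>\<^bsub>levi\<^esub> d2)"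
      unfolding comm[OF s(2) dl(1), symmetric] using s dl g by (simp add: m_assoc)
    finally show ?case using s d
      by (intro exI[of _ "s1 * s2"] exI[of _ "d1 \<otimes>\<^bsub>levi\<^esub> d2"]) (simp add: gmult)
  qed
  then show ?thesis by (simp add: levi_simps)
qed

section \<open>The character and the map to the monoid\<close>

lemma (in group) hom_to_comm_group_derived:
  assumes "comm_group H" "\<chi> \<in> hom G H" "x \<in> derived G (carrier G)"
  shows "\<chi> x = \<one>\<^bsub>H\<^esub>"
proof -
  interpret H: comm_group H by (rule assms(1))
  interpret group_hom G H \<chi> by unfold_locales (rule assms(2))
  have "\<chi> ` derived G (carrier G) = derived H (\<chi> ` carrier G)"
    using derived_img[of "carrier G"] by simp
  also have "\<dots> \<subseteq> derived H (carrier H)"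
    by (rule H.mono_derived) auto
  also have "\<dots> = {\<one>\<^bsub>H\<^esub>}" by (rule H.derived_eq_singleton) simp
  finally show ?thesis using assms(3) by blast
qed

lemma comm_group_Gm: "comm_group (Gm :: 'k::field monoid)"
proof (rule comm_groupI)
  fix x :: 'k assume "x \<in> carrier Gm"
  then show "\<exists>y\<in>carrier Gm. y \<otimes>\<^bsub>Gm\<^esub> x = \<one>\<^bsub>Gm\<^esub>"
    by (intro bexI[of _ "inverse x"]) (auto simp: Gm_def)
qed (auto simp: Gm_def)

lemma gamma0_character_levi_der:
  assumes "gamma0_character \<chi>" "d \<in> carrier levi_der"
  shows "\<chi> d = 1"
proof -
  have "\<chi> d = \<one>\<^bsub>Gm\<^esub>"
    using assms group.hom_to_comm_group_derived[OF group_levi comm_group_Gm, of \<chi> d]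
    by (simp add: gamma0_character_def levi_der_def)
  then show ?thesis by (simp add: Gm_def)
qed

lemma gamma0_character_value:
  assumes \<chi>: "gamma0_character \<chi>" and t: "t \<noteq> 0" and d: "d \<in> carrier levi_der"
  shows "\<chi> (gamma0_coroot t * d) = t ^ 2"
proof -
  have "d \<in> carrier levi" using d subgroup.subset[OF subgroup_levi_der] by blast
  then have "\<chi> (gamma0_coroot t * d) = \<chi> (gamma0_coroot t) * \<chi> d"
    using \<chi> hom_mult[of \<chi> levi Gm "gamma0_coroot t" d] gamma0_coroot_in_levi[OF t]
    by (simp add: gamma0_character_def levi_simps Gm_def)
  moreover have "\<chi> (gamma0_coroot t) = t ^ 2"
    using \<chi> t gamma0_at_gamma0_coroot[OF t]
    by (simp add: gamma0_character_def gamma0_coroot_def)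
  ultimately show ?thesis using gamma0_character_levi_der[OF \<chi> d] by simp
qed

lemma det_mat_diag: "det (mat_diag n f :: 'k::field mat) = (\<Prod>i<n. f i)"
proof -
  have "det (mat_diag n f) = prod_list (diag_mat (mat_diag n f))"
    by (rule det_upper_triangular) (auto simp: mat_diag_def)
  also have "\<dots> = (\<Prod>i<n. f i)"
    by (simp add: prod_list_diag_prod mat_diag_def atLeast0LessThan)
  finally show ?thesis .
qed

lemma carrier_SL: "carrier (SL n :: 'k::field mat monoid) = {A \<in> carrier_mat n n. det A = 1}"
proof -
  have "A \<in> Units (ring_mat TYPE('k) n ())" if "A \<in> carrier_mat n n" "det A = 1" for A :: "'k mat"
    using det_non_zero_imp_unit[OF that(1)] that(2) by simp
  then show ?thesis by (auto simp: SL_def GL_def units_of_def Units_def ring_mat_simps)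
qed

lemma std_coroot_mat_diag:
  "std_coroot k t = mat_diag 6 (\<lambda>i. if i = k then t else if i = Suc k then inverse t else 1)"
  by (auto simp: std_coroot_def mat_diag_def)

lemma std_coroot_in_SL:
  assumes "k < 5" "t \<noteq> 0"
  shows "std_coroot k t \<in> carrier (SL 6)"
proof -
  have "{..<6::nat} = {0,1,2,3,4,5}" by auto
  moreover have "k = 0 \<or> k = 1 \<or> k = 2 \<or> k = 3 \<or> k = 4" using assms by auto
  ultimately show ?thesis using assms
    by (auto simp: carrier_SL std_coroot_mat_diag det_mat_diag)
qed

lemma SL6_identification_mult:
  assumes "SL6_identification \<phi>" "x \<in> carrier (SL 6)" "y \<in> carrier (SL 6)"
  shows "\<phi> (x * y) = \<phi> x * \<phi> y"
  using assms hom_mult[of \<phi> "SL 6" levi_der x y]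
  by (simp add: SL6_identification_def iso_def SL_simps levi_simps)

lemma SL_mult: "x \<in> carrier (SL n) \<Longrightarrow> y \<in> carrier (SL n) \<Longrightarrow> x * y \<in> carrier (SL n)"
  by (auto simp: carrier_SL det_mult)

text \<open>
  \<open>A\<^sub>M\<close> and \<open>M\<^sub>D\<close> meet nontrivially: the coefficients of \<open>\<gamma>\<^sub>0\<^sup>\<vee>\<close> are odd exactly at
  \<open>\<alpha>\<^sub>1\<^sup>\<vee>, \<alpha>\<^sub>4\<^sup>\<vee>, \<alpha>\<^sub>6\<^sup>\<vee>\<close>, which \<open>\<phi>\<close> matches with the first, third and fifth coroots of \<open>SL\<^sub>6\<close>, and these three
  coroots at \<open>-1\<close> multiply to \<open>-1\<close>.
\<close>

lemma SL6_identification_minus_one: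
  assumes \<phi>: "SL6_identification \<phi>"
  shows "- 1\<^sub>m 6 \<in> carrier (SL 6)" "\<phi> (- 1\<^sub>m 6) = gamma0_coroot (-1)"
proof -
  let ?\<sigma> = "\<lambda>k. std_coroot k (-1)"
  have \<sigma>: "?\<sigma> k \<in> carrier (SL 6)" if "k < 5" for k using that by (simp add: std_coroot_in_SL)
  have prod: "- 1\<^sub>m 6 = ?\<sigma> 0 * ?\<sigma> 2 * ?\<sigma> 4"
    unfolding std_coroot_mat_diag mat_diag_diag
    by (rule eq_matI) (auto simp: mat_diag_def)
  show "- 1\<^sub>m 6 \<in> carrier (SL 6)" unfolding prod by (intro SL_mult \<sigma>) auto
  have "\<phi> (- 1\<^sub>m 6) = \<phi> (?\<sigma> 0) * \<phi> (?\<sigma> 2) * \<phi> (?\<sigma> 4)"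
    unfolding prod by (simp add: SL6_identification_mult[OF \<phi>] SL_mult \<sigma>)
  also have "\<dots> = coroot 1 (-1) * coroot 4 (-1) * coroot 6 (-1)"
    using \<phi> by (simp add: SL6_identification_def)
  also have "\<dots> = gamma0_coroot (-1)"
    by (simp add: gamma0_coroot_def torus_elt_def coroot_mat_diag gamma0_coeff_def
        del: mat_diag_one)
  finally show "\<phi> (- 1\<^sub>m 6) = gamma0_coroot (-1)" .
qed

text \<open>
  The content is the uniqueness of the pair \<open>(t\<^sup>2, t x)\<close>. The character \<open>\<chi>\<close> serves to determine \<open>t\<close> up to
  sign, and the change \<open>(t, x) \<mapsto> (-t, -x)\<close> made possible by \<open>\<gamma>\<^sub>0\<^sup>\<vee>(-1) = \<phi>(-1)\<close> preserves the pair.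
\<close>

lemma xi_gamma0_coroot_mult:
  fixes \<phi> :: "'f::field alg_closure mat \<Rightarrow> 'f alg_closure mat"
    and \<chi> :: "'f alg_closure mat \<Rightarrow> 'f alg_closure"
  assumes \<phi>: "SL6_identification \<phi>" and \<chi>: "gamma0_character \<chi>"
    and t: "t \<noteq> 0" and x: "x \<in> carrier (SL 6)"
  shows "xi \<phi> (gamma0_coroot t * \<phi> x) = (t ^ 2, t \<cdot>\<^sub>m x)"
  unfolding xi_def
proof (rule the_equality)
  show "\<exists>s y. s \<noteq> 0 \<and> y \<in> carrier (SL 6) \<and>
      gamma0_coroot t * \<phi> x = gamma0_coroot s * \<phi> y \<and> (t ^ 2, t \<cdot>\<^sub>m x) = (s ^ 2, s \<cdot>\<^sub>m y)"
    using t x by blast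
next
  fix p
  assume "\<exists>s y. s \<noteq> 0 \<and> y \<in> carrier (SL 6) \<and>
      gamma0_coroot t * \<phi> x = gamma0_coroot s * \<phi> y \<and> p = (s ^ 2, s \<cdot>\<^sub>m y)"
  then obtain s y where s: "s \<noteq> 0" and y: "y \<in> carrier (SL 6)"
    and eq: "gamma0_coroot t * \<phi> x = gamma0_coroot s * \<phi> y" and p: "p = (s ^ 2, s \<cdot>\<^sub>m y)"
    by blast
  interpret group "levi :: 'f alg_closure mat monoid" by (rule group_levi)
  have der: "\<phi> z \<in> carrier levi_der" if "z \<in> carrier (SL 6)" for z
    using \<phi> that by (auto simp: SL6_identification_def iso_def bij_betw_def)
  then have levi: "\<phi> z \<in> carrier levi" if "z \<in> carrier (SL 6)" for z
    using that subgroup.subset[OF subgroup_levi_der] by blast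
  have inj: "inj_on \<phi> (carrier (SL 6))"
    using \<phi> by (auto simp: SL6_identification_def iso_def bij_betw_def)
  have cancel: "z = w"
    if "gamma0_coroot t * \<phi> z = gamma0_coroot t * \<phi> w" "z \<in> carrier (SL 6)" "w \<in> carrier (SL 6)" for z w
    using that l_cancel[of "gamma0_coroot t" "\<phi> z" "\<phi> w"] gamma0_coroot_in_levi[OF t] levi inj
    by (auto simp: levi_simps dest: inj_onD)
  have sq: "t ^ 2 = s ^ 2"
    using gamma0_character_value[OF \<chi> t der[OF x]] gamma0_character_value[OF \<chi> s der[OF y]] eq
    by simp
  then consider "s = t" | "s = - t" by (auto simp: power2_eq_iff)
  then have "t \<cdot>\<^sub>m x = s \<cdot>\<^sub>m y"
  proof cases
    case 1
    then show ?thesis using cancel[OF _ x y] eq by simp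
  next
    case 2
    note one = SL6_identification_minus_one[OF \<phi>]
    have "gamma0_coroot t * \<phi> x = gamma0_coroot t * gamma0_coroot (-1) * \<phi> y"
      by (simp add: eq 2 gamma0_coroot_mult)
    also have "\<dots> = gamma0_coroot t * (gamma0_coroot (-1) * \<phi> y)"
      using levi_carrier_mat gamma0_coroot_in_levi t levi[OF y]
      by (intro assoc_mult_mat[of _ 27 27 _ 27 _ 27]) auto
    also have "\<dots> = gamma0_coroot t * \<phi> (- 1\<^sub>m 6 * y)"
      by (simp add: SL6_identification_mult[OF \<phi> one(1) y] one(2))
    finally have "x = - 1\<^sub>m 6 * y" using cancel x y SL_mult one(1) by blast
    also have "\<dots> = - y" using y by (auto simp: carrier_SL)
    finally show ?thesis using y 2 by (auto simp: carrier_SL intro!: eq_matI)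
  qed
  then show "p = (t ^ 2, t \<cdot>\<^sub>m x)" using sq p by simp
qed

theorem lemma3p1:
  fixes v :: "'f::field_char_0 \<Rightarrow> real"
    and \<phi> :: "'f alg_closure mat \<Rightarrow> 'f alg_closure mat"
    and \<gamma>0 :: "'f alg_closure mat \<Rightarrow> 'f alg_closure"
  assumes "padic_field v"
    and "SL6_identification \<phi>"
    and "gamma0_character \<gamma>0"
  shows "\<forall>m\<in>carrier levi. (nu \<circ> xi \<phi>) m = \<gamma>0 m"
proof
  fix m :: "'f alg_closure mat"
  assume "m \<in> carrier levi"
  then obtain s d where s: "s \<noteq> 0" and d: "d \<in> carrier levi_der" and m: "m = gamma0_coroot s * d"
    using levi_decomposition by blast
  have "\<phi> ` carrier (SL 6) = carrier levi_der"
    using assms(2) by (auto simp: SL6_identification_def iso_def bij_betw_def)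
  with d obtain x where x: "x \<in> carrier (SL 6)" "d = \<phi> x" by auto
  have "(nu \<circ> xi \<phi>) m = s ^ 2"
    using xi_gamma0_coroot_mult[OF assms(2,3) s x(1)] by (simp add: nu_def m x(2))
  also have "\<dots> = \<gamma>0 m"
    using gamma0_character_value[OF assms(3) s d] by (simp add: m)
  finally show "(nu \<circ> xi \<phi>) m = \<gamma>0 m" .
qed

end
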